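(* Let $L$ be a set. For any simple $L$-labeled metric space $(X,\alpha)$, the travel time map $R\colon X\to C(\partial X)$ is an isometric embedding of $X$ into $(C(\partial X),\|\cdot\|_\infty)$. Particularly, the closure $\overline{R(X)}$, regarded as a compact metric space, determines the $L$-labeled space $X$ uniquely up to isometry: if $(X,\alpha)$ and $(Y,\beta)$ are simple $L$-labeled metric spaces whose travel time data closures $\overline{R(X)}$ and $\overline{R(Y)}$ are isometric, then $X$ and $Y$ are isometric.
   Context: All metric spaces are assumed to be compact. Given a set $L$, an $L$-labeled metric space is a pair $(X,\alpha)$ where $X$ is a (compact) metric space and $\alpha\colon L\to X$ is an arbitrary map. Write $\partial X:=\alpha(L)\subseteq X$. For $x\in X$ define $r_x\colon\partial X\to\mathbb{R}$, $r_x(z):=d_X(x,z)$. The travel time map is $R\colon X\to C(\partial X)$, $R(x):=r_x$; the travel time data of $X$ is $R(X)=\{r_x : x\in X\}$, and $\overline{R(X)}$ is its closure with respect to the supremum norm $\|\cdot\|_\infty$, viewed as a metric space with the induced metric. In a length metric space, $l(\gamma)$ denotes the length of a path $\gamma$, and geodesics are the paths that are locally distance minimizing. Let $X$ be a compact length metric space with labeling $\alpha\colon L\to X$. The pair $(X,\alpha)$ is a simple $L$-labeled metric space if: (1) any geodesic segment in $X$ can be extended to a finite length geodesic segment with end points in $\partial X$; (2) for any two points $x,y\in X$ there exists a unique geodesic $\gamma_{xy}$ of $X$ whose end points are $x$ and $y$; (3) for any $x\in X$ the function $\tau_x\colon\partial X\to\mathbb{R}$, $\tau_x(z)=l(\gamma_{xz})$,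 is continuous. *)

theory Defs
  imports "HOL-Analysis.Analysis"
begin

definition isometric_embedding :: "'a metric \<Rightarrow> 'b metric \<Rightarrow> ('a \<Rightarrow> 'b) \<Rightarrow> bool" where
  "isometric_embedding X Y f \<longleftrightarrow>
     f \<in> mspace X \<rightarrow> mspace Y \<and>
     (\<forall>x\<in>mspace X. \<forall>y\<in>mspace X. mdist Y (f x) (f y) = mdist X x y)"

definition isometric :: "'a metric \<Rightarrow> 'b metric \<Rightarrow> bool" where
  "isometric X Y \<longleftrightarrow> (\<exists>f. isometric_embedding X Y f \<and> f ` mspace X = mspace Y)"

text \<open>
  The length of the restriction of \<open>\<gamma>\<close> to \<open>{a..b}\<close>, as the supremum of the lengths of inscribed
  polygons; the partition points are \<open>t 0 \<le> \<dots> \<le> t n\<close>.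
\<close>
definition path_length :: "'a metric \<Rightarrow> real \<Rightarrow> real \<Rightarrow> (real \<Rightarrow> 'a) \<Rightarrow> ennreal" where
  "path_length X a b \<gamma> =
     Sup {ennreal (\<Sum>i<n. mdist X (\<gamma> (t i)) (\<gamma> (t (Suc i)))) | n t.
            t (0::nat) = a \<and> t n = b \<and> mono_on {..n} t}"

text \<open>
  The infimum over the empty set is \<open>\<infinity>\<close> in \<^typ>\<open>ennreal\<close>, so any two points of a length metric
  space are joined by a path of finite length.
\<close>
definition length_metric_space :: "'a metric \<Rightarrow> bool" where
  "length_metric_space X \<longleftrightarrow>
     (\<forall>x\<in>mspace X. \<forall>y\<in>mspace X.
        ennreal (mdist X x y) =
          Inf {path_length X 0 1 \<gamma> | \<gamma>. pathin (mtopology_of X) \<gamma> \<and> \<gamma> 0 = x \<and> \<gamma> 1 = y})"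

definition locally_minimizing :: "'a metric \<Rightarrow> real \<Rightarrow> (real \<Rightarrow> 'a) \<Rightarrow> bool" where
  "locally_minimizing X T \<gamma> \<longleftrightarrow>
     (\<forall>t\<in>{0..T}. \<exists>e>0. \<forall>u\<in>{0..T}. \<forall>v\<in>{0..T}.
        u \<le> v \<and> \<bar>u - t\<bar> < e \<and> \<bar>v - t\<bar> < e \<longrightarrow>
        path_length X u v \<gamma> = ennreal (mdist X (\<gamma> u) (\<gamma> v)))"

text \<open>
  A geodesic segment is a locally distance minimizing path, taken with its arc length
  parametrization, so that identity of geodesics does not depend on the choice of a
  parametrization. It is a pair \<open>(T, \<gamma>)\<close> of its length \<open>T\<close> and a map \<open>\<gamma>\<close> on \<open>{0..T}\<close>, which is made
  extensional (\<open>undefined\<close> off \<open>{0..T}\<close>) so that equality of pairs is equality of paths. The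
  constant path at a point is the case \<open>T = 0\<close>.
\<close>
fun geodesic_segment :: "'a metric \<Rightarrow> real \<times> (real \<Rightarrow> 'a) \<Rightarrow> bool" where
  "geodesic_segment X (T, \<gamma>) \<longleftrightarrow>
     0 \<le> T \<and> \<gamma> \<in> extensional {0..T} \<and>
     continuous_map (top_of_set {0..T}) (mtopology_of X) \<gamma> \<and>
     locally_minimizing X T \<gamma> \<and>
     (\<forall>u\<in>{0..T}. \<forall>v\<in>{0..T}. u \<le> v \<longrightarrow> path_length X u v \<gamma> = ennreal (v - u))"

fun seg_source :: "real \<times> (real \<Rightarrow> 'a) \<Rightarrow> 'a" where
  "seg_source (T, \<gamma>) = \<gamma> 0"

fun seg_target :: "real \<times> (real \<Rightarrow> 'a) \<Rightarrow> 'a" where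
  "seg_target (T, \<gamma>) = \<gamma> T"

fun seg_length :: "'a metric \<Rightarrow> real \<times> (real \<Rightarrow> 'a) \<Rightarrow> ennreal" where
  "seg_length X (T, \<gamma>) = path_length X 0 T \<gamma>"

text \<open>The second segment extends the first one.\<close>
fun seg_extended_by :: "real \<times> (real \<Rightarrow> 'a) \<Rightarrow> real \<times> (real \<Rightarrow> 'a) \<Rightarrow> bool" where
  "seg_extended_by (T, \<gamma>) (T', \<gamma>') \<longleftrightarrow>
     (\<exists>s\<ge>0. s + T \<le> T' \<and> (\<forall>t\<in>{0..T}. \<gamma>' (s + t) = \<gamma> t))"

definition geodesic_joining :: "'a metric \<Rightarrow> 'a \<Rightarrow> 'a \<Rightarrow> real \<times> (real \<Rightarrow> 'a) \<Rightarrow> bool" where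
  "geodesic_joining X x y p \<longleftrightarrow> geodesic_segment X p \<and> seg_source p = x \<and> seg_target p = y"

text \<open>The length of \<open>\<gamma>\<^bsub>xz\<^esub>\<close>; only meaningful if there is a unique geodesic joining \<open>x\<close> and \<open>z\<close>.\<close>
definition geodesic_length :: "'a metric \<Rightarrow> 'a \<Rightarrow> 'a \<Rightarrow> real" where
  "geodesic_length X x z = enn2real (seg_length X (THE p. geodesic_joining X x z p))"

definition labeled_metric_space :: "'l set \<Rightarrow> 'a metric \<Rightarrow> ('l \<Rightarrow> 'a) \<Rightarrow> bool" where
  "labeled_metric_space L X \<alpha> \<longleftrightarrow> compact_space (mtopology_of X) \<and> \<alpha> \<in> L \<rightarrow> mspace X"

definition label_boundary :: "'l set \<Rightarrow> ('l \<Rightarrow> 'a) \<Rightarrow> 'a set" where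
  "label_boundary L \<alpha> = \<alpha> ` L"

definition simple_labeled_metric_space :: "'l set \<Rightarrow> 'a metric \<Rightarrow> ('l \<Rightarrow> 'a) \<Rightarrow> bool" where
  "simple_labeled_metric_space L X \<alpha> \<longleftrightarrow>
     labeled_metric_space L X \<alpha> \<and> length_metric_space X \<and>
     (\<forall>p. geodesic_segment X p \<longrightarrow>
        (\<exists>q. geodesic_segment X q \<and> seg_extended_by p q \<and> seg_length X q < \<infinity> \<and>
             seg_source q \<in> label_boundary L \<alpha> \<and> seg_target q \<in> label_boundary L \<alpha>)) \<and>
     (\<forall>x\<in>mspace X. \<forall>y\<in>mspace X. \<exists>!p. geodesic_joining X x y p) \<and>
     (\<forall>x\<in>mspace X.
        continuous_map (subtopology (mtopology_of X) (label_boundary L \<alpha>)) euclideanreal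
          (geodesic_length X x))"

text \<open>
  \<open>C(\<partial>X)\<close> with the supremum metric. The boundary need not be closed in \<open>X\<close>, and \<^const>\<open>cfunspace\<close>
  consists of the bounded continuous functions; all travel time functions are bounded since \<open>X\<close> is.
\<close>
definition boundary_functions ::
    "'l set \<Rightarrow> 'a metric \<Rightarrow> ('l \<Rightarrow> 'a) \<Rightarrow> ('a \<Rightarrow> real) metric" where
  "boundary_functions L X \<alpha> =
     cfunspace (subtopology (mtopology_of X) (label_boundary L \<alpha>)) euclidean_metric"

definition travel_time_map :: "'l set \<Rightarrow> 'a metric \<Rightarrow> ('l \<Rightarrow> 'a) \<Rightarrow> 'a \<Rightarrow> 'a \<Rightarrow> real" where
  "travel_time_map L X \<alpha> x = (\<lambda>z\<in>label_boundary L \<alpha>. mdist X x z)"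

definition travel_time_closure ::
    "'l set \<Rightarrow> 'a metric \<Rightarrow> ('l \<Rightarrow> 'a) \<Rightarrow> ('a \<Rightarrow> real) metric" where
  "travel_time_closure L X \<alpha> =
     submetric (boundary_functions L X \<alpha>)
       (mtopology_of (boundary_functions L X \<alpha>) closure_of (travel_time_map L X \<alpha> ` mspace X))"

end

theory Submission
  imports Defs
begin

text \<open>
  A compact length space is geodesic: given \<open>x\<close> and \<open>y\<close> at distance \<open>D\<close>, points on almost shortest
  paths yield maps \<open>{0..D} \<rightarrow> X\<close> that are \<open>1\<close>-Lipschitz up to an arbitrarily small additive error,
  and Tychonoff compactness of the space of all maps \<open>{0..D} \<rightarrow> X\<close> turns these into an exactly
  distance preserving map. Since geodesics are unique, every geodesic segment is therefore
  globally minimizing. Extending \<open>\<gamma>\<^bsub>xy\<^esub>\<close> beyond \<open>y\<close> up to a boundary point \<open>w\<close> gives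
  \<open>d(x,w) = d(x,y) + d(y,w)\<close>, so the supremum of \<open>\<bar>r\<^sub>x - r\<^sub>y\<bar>\<close> is at least \<open>d(x,y)\<close>; the converse
  is the triangle inequality. Finally \<open>R(X)\<close> is compact, hence equal to its closure.
\<close>

section \<open>Isometries\<close>

lemma isometric_embedding_imp_continuous_map:
  assumes "isometric_embedding X Y f"
  shows "continuous_map (mtopology_of X) (mtopology_of Y) f"
proof (rule Lipschitz_continuous_imp_continuous_map)
  show "Lipschitz_continuous_map X Y f"
    using assms unfolding Lipschitz_continuous_map_def isometric_embedding_def
    by (intro conjI exI[of _ 1]) auto
qed

lemma isometric_trans:
  assumes "isometric X Y" "isometric Y Z"
  shows "isometric X Z"
proof -
  obtain f g where f: "isometric_embedding X Y f" "f ` mspace X = mspace Y"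
    and g: "isometric_embedding Y Z g" "g ` mspace Y = mspace Z"
    using assms unfolding isometric_def by blast
  have "isometric_embedding X Z (g \<circ> f)"
    using f(1) g(1) unfolding isometric_embedding_def by (auto simp: Pi_iff)
  moreover have "(g \<circ> f) ` mspace X = mspace Z"
    using f(2) g(2) by (metis image_comp)
  ultimately show ?thesis
    unfolding isometric_def by blast
qed

lemma isometric_sym:
  assumes "isometric X Y"
  shows "isometric Y X"
proof -
  obtain f where f: "isometric_embedding X Y f" "f ` mspace X = mspace Y"
    using assms unfolding isometric_def by blast
  define g where "g = inv_into (mspace X) f"
  have g: "g y \<in> mspace X" "f (g y) = y" if "y \<in> mspace Y" for y
    using f(2) that unfolding g_def by (auto intro: inv_into_into f_inv_into_f)
  have "g (f x) = x" if "x \<in> mspace X" for x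
  proof -
    have fx: "f x \<in> mspace Y"
      using f(2) that by blast
    \<comment> \<open>Distance preservation gives injectivity: \<open>g (f x)\<close> and
      \<open>x\<close> have the same image under \<open>f\<close>, so their distance is
      zero.\<close>
    have "mdist X (g (f x)) x = mdist Y (f (g (f x))) (f x)"
      using f(1) g(1)[OF fx] that unfolding isometric_embedding_def by auto
    also have "\<dots> = 0"
      using g(2)[OF fx] fx by simp
    finally show ?thesis
      using g(1)[OF fx] that by simp
  qed
  then have "g ` mspace Y = mspace X"
    using g(1) f(2) by force
  moreover have "isometric_embedding Y X g"
    unfolding isometric_embedding_def
  proof (intro conjI ballI)
    show "g \<in> mspace Y \<rightarrow> mspace X"
      using g(1) by blast
    fix x y assume "x \<in> mspace Y" "y \<in> mspace Y"
    then show "mdist X (g x) (g y) = mdist Y x y"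
      using f(1) g unfolding isometric_embedding_def by metis
  qed
  ultimately show ?thesis
    unfolding isometric_def by blast
qed

section \<open>Shortest paths in compact length spaces\<close>

text \<open>The polygon with vertices at the times 0, a, b, 1 is one of those in the supremum. Two
  intermediate vertices suffice to control the distance between two points of an almost shortest
  path.\<close>

lemma path_length_ge_three_edges:
  assumes "0 \<le> a" "a \<le> b" "b \<le> 1"
  shows "ennreal (mdist X (\<gamma> 0) (\<gamma> a) + mdist X (\<gamma> a) (\<gamma> b) + mdist X (\<gamma> b) (\<gamma> 1))
         \<le> path_length X 0 1 \<gamma>"
proof -
  define t :: "nat \<Rightarrow> real" where
    "t i = (if i = 0 then 0 else if i = 1 then a else if i = 2 then b else 1)" for i
  have "mono_on {..3} t"
    using assms unfolding mono_on_def t_def by auto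
  moreover have "(\<Sum>i<3. mdist X (\<gamma> (t i)) (\<gamma> (t (Suc i)))) =
      mdist X (\<gamma> 0) (\<gamma> a) + mdist X (\<gamma> a) (\<gamma> b) + mdist X (\<gamma> b) (\<gamma> 1)"
    by (simp add: eval_nat_numeral t_def)
  moreover have "t 0 = 0" "t 3 = 1"
    by (simp_all add: t_def)
  ultimately show ?thesis
    unfolding path_length_def by (intro Sup_upper CollectI exI[of _ 3] exI[of _ t]) simp
qed

text \<open>On a path from \<open>x\<close> to \<open>y\<close> of length below
  \<open>D + e\<close>, let \<open>f s\<close> be a point at distance exactly \<open>s\<close> from
  \<open>x\<close>. Any detour between two such points costs at most the excess
  \<open>e\<close>.\<close>

lemma length_metric_space_approx_geodesic:
  assumes X: "length_metric_space X" and x: "x \<in> mspace X" and y: "y \<in> mspace X" and "e > 0"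
  defines "D \<equiv> mdist X x y"
  obtains f where "f \<in> {0..D} \<rightarrow>\<^sub>E mspace X" "mdist X (f 0) x \<le> e" "mdist X (f D) y \<le> e"
    "\<And>s t. s \<in> {0..D} \<Longrightarrow> t \<in> {0..D} \<Longrightarrow> mdist X (f s) (f t) \<le> \<bar>s - t\<bar> + e"
proof -
  have "Inf {path_length X 0 1 \<gamma> | \<gamma>. pathin (mtopology_of X) \<gamma> \<and> \<gamma> 0 = x \<and> \<gamma> 1 = y} = ennreal D"
    using X[unfolded length_metric_space_def, rule_format, OF x y] by (simp add: D_def)
  also have "\<dots> < ennreal (D + e)"
    using \<open>e > 0\<close> by (simp add: D_def ennreal_less_iff)
  finally obtain \<gamma> where \<gamma>: "pathin (mtopology_of X) \<gamma>" "\<gamma> 0 = x" "\<gamma> 1 = y"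
    and len: "path_length X 0 1 \<gamma> < ennreal (D + e)"
    unfolding Inf_less_iff by blast
  have cont: "continuous_map (top_of_set {0..1}) (mtopology_of X) \<gamma>"
    using \<gamma>(1) unfolding pathin_def .
  have in_X: "\<gamma> t \<in> mspace X" if "t \<in> {0..1}" for t
    using continuous_map_image_subset_topspace[OF cont] that by auto
  \<comment> \<open>The last edge of the polygon, from \<open>\<gamma> b\<close> to
    \<open>y\<close>, is eliminated by the triangle inequality, which bounds it below by D - d(x,
    \<gamma> b).\<close>
  have polygon: "D + mdist X (\<gamma> a) (\<gamma> b) \<le> D + e + mdist X x (\<gamma> b) - mdist X x (\<gamma> a)"
    if "0 \<le> a" "a \<le> b" "b \<le> 1" for a b
  proof -
    have "mdist X x (\<gamma> a) + mdist X (\<gamma> a) (\<gamma> b) + mdist X (\<gamma> b) y < D + e"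
      using le_less_trans[OF path_length_ge_three_edges[OF that, of X \<gamma>] len]
      by (simp add: \<gamma>(2,3) ennreal_less_iff del: ennreal_plus)
    moreover have "D \<le> mdist X x (\<gamma> b) + mdist X (\<gamma> b) y"
      unfolding D_def using x y in_X[of b] that by (intro mdist_triangle) auto
    ultimately show ?thesis
      by linarith
  qed
  have "continuous_on {0..1} (\<lambda>t. mdist X x (\<gamma> t))"
    using continuous_map_mdist[OF _ cont, of "\<lambda>_. x"] x by simp
  \<comment> \<open>The distance from \<open>x\<close> runs from 0 to \<open>D\<close> along the
    path, so every value is attained. The choice \<open>u\<close> need not be monotone, hence the
    case distinction at the end.\<close>
  then have "\<exists>u\<in>{0..1}. mdist X x (\<gamma> u) = s" if "s \<in> {0..D}" for s
    using IVT'[of "\<lambda>t. mdist X x (\<gamma> t)" 0 s 1] that mdist_zero[OF x x]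
    by (force simp: \<gamma>(2,3) D_def)
  then obtain u where u: "\<And>s. s \<in> {0..D} \<Longrightarrow> u s \<in> {0..1} \<and> mdist X x (\<gamma> (u s)) = s"
    by metis
  define f where "f = restrict (\<lambda>s. \<gamma> (u s)) {0..D}"
  have "D \<ge> 0"
    by (simp add: D_def)
  show thesis
  proof
    show "f \<in> {0..D} \<rightarrow>\<^sub>E mspace X"
      using u in_X by (auto simp: f_def)
    show "mdist X (f 0) x \<le> e"
      using u[of 0] \<open>D \<ge> 0\<close> \<open>e > 0\<close> by (simp add: f_def mdist_commute)
    \<comment> \<open>The point \<open>f D\<close> has the right distance from \<open>x\<close> but
      may differ from \<open>y\<close>; taking b = 1 bounds the error.\<close>
    show "mdist X (f D) y \<le> e"
      using u[of D] \<open>D \<ge> 0\<close> polygon[of "u D" 1] by (simp add: f_def \<gamma>(3) D_def)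
    fix s t assume st: "s \<in> {0..D}" "t \<in> {0..D}"
    show "mdist X (f s) (f t) \<le> \<bar>s - t\<bar> + e"
    proof (cases "u s \<le> u t")
      case True
      then show ?thesis
        using polygon[of "u s" "u t"] u[OF st(1)] u[OF st(2)] st by (simp add: f_def)
    next
      case False
      then show ?thesis
        using polygon[of "u t" "u s"] u[OF st(1)] u[OF st(2)] st
        by (simp add: f_def mdist_commute)
    qed
  qed
qed

lemma compact_length_space_geodesic:
  assumes K: "compact_space (mtopology_of X)" and X: "length_metric_space X"
    and x: "x \<in> mspace X" and y: "y \<in> mspace X"
  defines "D \<equiv> mdist X x y"
  obtains f where "f \<in> {0..D} \<rightarrow>\<^sub>E mspace X" "f 0 = x" "f D = y"
    "\<And>s t. s \<in> {0..D} \<Longrightarrow> t \<in> {0..D} \<Longrightarrow> mdist X (f s) (f t) = \<bar>s - t\<bar>"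
proof -
  define P where "P = product_topology (\<lambda>_::real. mtopology_of X) {0..D}"
  define e :: "nat \<Rightarrow> real" where "e n = inverse (Suc n)" for n
  define C where "C n = {f \<in> topspace P. mdist X (f 0) x \<le> e n \<and> mdist X (f D) y \<le> e n \<and>
      (\<forall>s\<in>{0..D}. \<forall>t\<in>{0..D}. mdist X (f s) (f t) \<le> \<bar>s - t\<bar> + e n)}" for n
  have "D \<ge> 0"
    by (simp add: D_def)
  have e_pos: "e n > 0" for n
    by (simp add: e_def)
  have top_P: "topspace P = {0..D} \<rightarrow>\<^sub>E mspace X"
    by (simp add: P_def)
  have "(\<Inter>n. C n) \<noteq> {}"
  proof (rule compact_space_imp_nest)
    show "compact_space P"
      using K by (simp add: P_def compact_space_product_topology)
    show "closedin P (C n)" for n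
    proof -
      have proj: "continuous_map P (mtopology_of X) (\<lambda>f. f s)" if "s \<in> {0..D}" for s
        unfolding P_def using that by (rule continuous_map_product_projection)
      have closed: "closedin P {f \<in> topspace P. mdist X (g f) (h f) \<le> b}"
        if "continuous_map P (mtopology_of X) g" "continuous_map P (mtopology_of X) h" for g h b
        using closedin_continuous_map_preimage[OF continuous_map_mdist[OF that], of "{..b}"] by simp
      \<comment> \<open>Each condition involves at most two coordinates of \<open>f\<close>, hence
        is closed. That \<open>D\<close> is nonnegative makes the index sets of the intersections
        nonempty.\<close>
      have "C n = {f \<in> topspace P. mdist X (f 0) x \<le> e n} \<inter> {f \<in> topspace P. mdist X (f D) y \<le> e n}
          \<inter> (\<Inter>s\<in>{0..D}. \<Inter>t\<in>{0..D}. {f \<in> topspace P. mdist X (f s) (f t) \<le> \<bar>s - t\<bar> + e n})"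
        using \<open>D \<ge> 0\<close> unfolding C_def by auto
      then show ?thesis
        using \<open>D \<ge> 0\<close> x y
        by (auto intro!: closedin_Int closedin_INT closed proj)
    qed
    show "C n \<noteq> {}" for n
    proof -
      obtain f where "f \<in> {0..D} \<rightarrow>\<^sub>E mspace X" "mdist X (f 0) x \<le> e n" "mdist X (f D) y \<le> e n"
        "\<And>s t. s \<in> {0..D} \<Longrightarrow> t \<in> {0..D} \<Longrightarrow> mdist X (f s) (f t) \<le> \<bar>s - t\<bar> + e n"
        using length_metric_space_approx_geodesic[OF X x y e_pos[of n]] unfolding D_def by blast
      then have "f \<in> C n"
        unfolding C_def top_P by simp
      then show ?thesis
        by blast
    qed
    show "decseq C"
    proof (rule decseq_SucI)
      fix n
      have "e (Suc n) \<le> e n"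
        by (simp add: e_def field_simps)
      then show "C (Suc n) \<subseteq> C n"
        unfolding C_def by fastforce
    qed
  qed
  then obtain f where f: "\<And>n. f \<in> C n"
    by blast
  have vanish: "a \<le> b" if "\<And>n. a \<le> b + e n" for a b
    using that LIMSEQ_inverse_real_of_nat_add[of b] unfolding e_def
    by (meson Lim_bounded2)
  have fX: "f \<in> {0..D} \<rightarrow>\<^sub>E mspace X"
    using f unfolding C_def top_P by blast
  have "mdist X (f 0) x \<le> 0" "mdist X (f D) y \<le> 0"
    by (rule vanish; use f in \<open>simp add: C_def\<close>)+
  then have ends: "f 0 = x" "f D = y"
    using fX x y \<open>D \<ge> 0\<close> by (auto simp: PiE_iff order_antisym_conv)
  have upper: "mdist X (f s) (f t) \<le> \<bar>s - t\<bar>" if "s \<in> {0..D}" "t \<in> {0..D}" for s t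
    by (rule vanish) (use f that in \<open>simp add: C_def\<close>)
  \<comment> \<open>By the upper bounds, the detour through \<open>f s\<close> and
    \<open>f t\<close> gives D \<le> s + d(f s, f t) + (D - t). Swapping \<open>s\<close> and
    \<open>t\<close> later yields the absolute value.\<close>
  have lower: "t - s \<le> mdist X (f s) (f t)" if "s \<in> {0..D}" "t \<in> {0..D}" for s t
  proof -
    have "f s \<in> mspace X" "f t \<in> mspace X"
      using fX that by auto
    then have "D \<le> mdist X x (f s) + mdist X (f s) (f t) + mdist X (f t) y"
      using mdist_triangle[of x X "f s" y] mdist_triangle[of "f s" X "f t" y] x y
      unfolding D_def by linarith
    then show ?thesis
      using upper[of 0 s] upper[of t D] that \<open>D \<ge> 0\<close> by (auto simp: ends)
  qed
  show thesis
  proof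
    show "mdist X (f s) (f t) = \<bar>s - t\<bar>" if "s \<in> {0..D}" "t \<in> {0..D}" for s t
      using upper[OF that] lower[OF that] lower[OF that(2,1)]
      by (auto simp: mdist_commute abs_real_def split: if_splits)
  qed (use fX ends in auto)
qed

section \<open>Distance preserving maps of intervals as geodesic segments\<close>

lemma path_length_distance_preserving:
  assumes "u \<le> v"
    and f: "\<And>s t. s \<in> {u..v} \<Longrightarrow> t \<in> {u..v} \<Longrightarrow> mdist X (f s) (f t) = \<bar>s - t\<bar>"
  shows "path_length X u v f = ennreal (v - u)"
proof -
  have polygon: "(\<Sum>i<n. mdist X (f (t i)) (f (t (Suc i)))) = v - u"
    if t: "t 0 = u" "t n = v" "mono_on {..n} t" for n and t :: "nat \<Rightarrow> real"
  proof -
    have "t i \<in> {u..v}" if "i \<le> n" for i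
      using mono_onD[OF t(3), of 0 i] mono_onD[OF t(3), of i n] t(1,2) that by auto
    \<comment> \<open>Monotonicity of \<open>t\<close> removes the absolute values, and the sum
      telescopes.\<close>
    then have "(\<Sum>i<n. mdist X (f (t i)) (f (t (Suc i)))) = (\<Sum>i<n. t (Suc i) - t i)"
      using mono_onD[OF t(3)]
      by (intro sum.cong) (simp_all add: f)
    then show ?thesis
      by (simp add: sum_lessThan_telescope t)
  qed
  \<comment> \<open>The one-edge partition shows that the set of polygon lengths is nonempty, so it
    is the singleton of \<open>v - u\<close>.\<close>
  have "\<exists>t. t (0::nat) = u \<and> t (Suc 0) = v \<and> mono_on {..Suc 0} t"
    using \<open>u \<le> v\<close> by (intro exI[of _ "\<lambda>i. if i = 0 then u else v"]) (auto simp: mono_on_def)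
  then have "{ennreal (\<Sum>i<n. mdist X (f (t i)) (f (t (Suc i)))) | n t.
      t 0 = u \<and> t n = v \<and> mono_on {..n} t} = {ennreal (v - u)}"
    using polygon by (intro equalityI subsetI) (auto, metis)
  then show ?thesis
    unfolding path_length_def by simp
qed

lemma distance_preserving_imp_geodesic_segment:
  assumes "0 \<le> T" and f: "f \<in> {0..T} \<rightarrow>\<^sub>E mspace X"
    and dist: "\<And>s t. s \<in> {0..T} \<Longrightarrow> t \<in> {0..T} \<Longrightarrow> mdist X (f s) (f t) = \<bar>s - t\<bar>"
  shows "geodesic_segment X (T, f)"
proof -
  have "isometric_embedding (submetric euclidean_metric {0..T}) X f"
    using f dist unfolding isometric_embedding_def by (auto simp: dist_real_def)
  then have "continuous_map (top_of_set {0..T}) (mtopology_of X) f"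
    using isometric_embedding_imp_continuous_map by (fastforce simp: mtopology_of_submetric)
  moreover have len: "path_length X u v f = ennreal (v - u)"
    if "u \<in> {0..T}" "v \<in> {0..T}" "u \<le> v" for u v
    using that by (intro path_length_distance_preserving dist) auto
  moreover have "locally_minimizing X T f"
    unfolding locally_minimizing_def using len dist by (auto intro!: exI[of _ 1])
  ultimately show ?thesis
    using \<open>0 \<le> T\<close> f by (auto simp: PiE_def)
qed

section \<open>Simple labeled metric spaces\<close>

lemma geodesic_segment_in_mspace:
  assumes "geodesic_segment X (T, \<gamma>)" "t \<in> {0..T}"
  shows "\<gamma> t \<in> mspace X"
proof -
  have "continuous_map (top_of_set {0..T}) (mtopology_of X) \<gamma>"
    using assms(1) by simp
  from continuous_map_image_subset_topspace[OF this] show ?thesis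
    using assms(2) by auto
qed

text \<open>A distance preserving segment with the same end points exists by compactness. Uniqueness
  of geodesics identifies it with the given, only locally minimizing, one.\<close>

lemma simple_geodesic_segment_mdist:
  assumes S: "simple_labeled_metric_space L X \<alpha>" and g: "geodesic_segment X (T, \<gamma>)"
    and st: "s \<in> {0..T}" "t \<in> {0..T}"
  shows "mdist X (\<gamma> s) (\<gamma> t) = \<bar>s - t\<bar>"
proof -
  have "0 \<le> T"
    using g by simp
  then have ends: "\<gamma> 0 \<in> mspace X" "\<gamma> T \<in> mspace X"
    by (simp_all add: geodesic_segment_in_mspace[OF g])
  define D where "D = mdist X (\<gamma> 0) (\<gamma> T)"
  have "compact_space (mtopology_of X)" "length_metric_space X"
    using S unfolding simple_labeled_metric_space_def labeled_metric_space_def by auto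
  from compact_length_space_geodesic[OF this ends]
  obtain f where f: "f \<in> {0..D} \<rightarrow>\<^sub>E mspace X" "f 0 = \<gamma> 0" "f D = \<gamma> T"
    and dist: "\<And>s t. s \<in> {0..D} \<Longrightarrow> t \<in> {0..D} \<Longrightarrow> mdist X (f s) (f t) = \<bar>s - t\<bar>"
    unfolding D_def by blast
  have "geodesic_segment X (D, f)"
    using f(1) dist by (intro distance_preserving_imp_geodesic_segment) (auto simp: D_def)
  then have "geodesic_joining X (\<gamma> 0) (\<gamma> T) (D, f)" "geodesic_joining X (\<gamma> 0) (\<gamma> T) (T, \<gamma>)"
    using f g unfolding geodesic_joining_def by auto
  \<comment> \<open>Equality of pairs yields both that \<open>T\<close> is the distance of the end
    points and that the maps agree.\<close>
  then have "(T, \<gamma>) = (D, f)"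
    using S ends unfolding simple_labeled_metric_space_def by blast
  then show ?thesis
    using dist st by simp
qed

lemma simple_exists_boundary_point_beyond:
  assumes S: "simple_labeled_metric_space L X \<alpha>" and x: "x \<in> mspace X" and y: "y \<in> mspace X"
  obtains w where "w \<in> label_boundary L \<alpha>" "mdist X x w = mdist X x y + mdist X y w"
proof -
  obtain T \<gamma> where p: "geodesic_joining X x y (T, \<gamma>)"
    using S x y unfolding simple_labeled_metric_space_def by (metis surj_pair)
  then have p': "geodesic_segment X (T, \<gamma>)" "\<gamma> 0 = x" "\<gamma> T = y"
    unfolding geodesic_joining_def by simp_all
  obtain T' \<gamma>' where q: "geodesic_segment X (T', \<gamma>')" "seg_extended_by (T, \<gamma>) (T', \<gamma>')"
    "\<gamma>' T' \<in> label_boundary L \<alpha>"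
    using S p'(1) unfolding simple_labeled_metric_space_def by (metis seg_target.simps surj_pair)
  obtain s where s: "s \<ge> 0" "s + T \<le> T'" "\<And>t. t \<in> {0..T} \<Longrightarrow> \<gamma>' (s + t) = \<gamma> t"
    using q(2) by auto
  have "T \<ge> 0"
    using p'(1) by simp
  then have "\<gamma>' s = x" "\<gamma>' (s + T) = y"
    using s(3)[of 0] s(3)[of T] p' by auto
  moreover note dist = simple_geodesic_segment_mdist[OF S q(1)]
  \<comment> \<open>The extended segment is again globally minimizing, so distances add up along the
    ordered times s \<le> s + T \<le> T'.\<close>
  have "mdist X (\<gamma>' s) (\<gamma>' T') = mdist X (\<gamma>' s) (\<gamma>' (s + T)) + mdist X (\<gamma>' (s + T)) (\<gamma>' T')"
    using s(1,2) \<open>T \<ge> 0\<close> by (simp add: dist)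
  ultimately show thesis
    using that q(3) by metis
qed

section \<open>The travel time map and its image\<close>

lemma topspace_label_boundary:
  assumes "labeled_metric_space L X \<alpha>"
  shows "topspace (subtopology (mtopology_of X) (label_boundary L \<alpha>)) = label_boundary L \<alpha>"
  using assms unfolding labeled_metric_space_def label_boundary_def by auto

text \<open>Boundedness comes from compactness of the whole space, since the boundary itself need
  not be closed.\<close>

lemma travel_time_map_in_mspace:
  assumes S: "labeled_metric_space L X \<alpha>" and x: "x \<in> mspace X"
  shows "travel_time_map L X \<alpha> x \<in> mspace (boundary_functions L X \<alpha>)"
proof -
  let ?B = "label_boundary L \<alpha>"
  let ?f = "travel_time_map L X \<alpha> x"
  have cont: "continuous_map (mtopology_of X) euclideanreal (mdist X x)"
    using continuous_map_mdist[of "mtopology_of X" X "\<lambda>_. x" "\<lambda>y. y"] x by simp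
  have "compact_space (mtopology_of X)"
    using S unfolding labeled_metric_space_def by blast
  then have "compactin euclideanreal (mdist X x ` mspace X)"
    using image_compactin[OF _ cont] by (metis compact_space_def topspace_mtopology_of)
  then have "bounded (mdist X x ` mspace X)"
    by (simp add: compact_imp_bounded)
  moreover have "?f ` ?B \<subseteq> mdist X x ` mspace X"
    using S unfolding labeled_metric_space_def travel_time_map_def label_boundary_def by auto
  ultimately have "bounded (?f ` ?B)"
    by (rule bounded_subset)
  moreover have "continuous_map (subtopology (mtopology_of X) ?B) euclideanreal ?f"
    by (rule continuous_map_eq[OF continuous_map_from_subtopology[OF cont]])
      (simp add: travel_time_map_def topspace_label_boundary[OF S])
  ultimately show ?thesis
    unfolding boundary_functions_def mspace_cfunspace topspace_label_boundary[OF S]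
    by (auto simp: travel_time_map_def)
qed

lemma isometric_embedding_travel_time_map:
  assumes S: "simple_labeled_metric_space L X \<alpha>"
  shows "isometric_embedding X (boundary_functions L X \<alpha>) (travel_time_map L X \<alpha>)"
  unfolding isometric_embedding_def
proof (intro conjI ballI)
  let ?R = "travel_time_map L X \<alpha>"
  have lab: "labeled_metric_space L X \<alpha>"
    using S unfolding simple_labeled_metric_space_def by blast
  note top = topspace_label_boundary[OF lab]
  show "?R \<in> mspace X \<rightarrow> mspace (boundary_functions L X \<alpha>)"
    using travel_time_map_in_mspace[OF lab] by blast
  have in_X: "z \<in> mspace X" if "z \<in> label_boundary L \<alpha>" for z
    using lab that unfolding labeled_metric_space_def label_boundary_def by auto
  fix x y assume x: "x \<in> mspace X" and y: "y \<in> mspace X"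
  have "\<bar>mdist X x z - mdist X y z\<bar> \<le> mdist X x y" if "z \<in> label_boundary L \<alpha>" for z
    using mdist_triangle[of x X y z] mdist_triangle[of y X x z] x y in_X[OF that]
    by (auto simp: abs_le_iff mdist_commute)
  then have "mdist (boundary_functions L X \<alpha>) (?R x) (?R y) \<le> mdist X x y"
    unfolding boundary_functions_def
    by (intro mdist_cfunspace_le) (auto simp: top travel_time_map_def dist_real_def)
  moreover have "mdist X x y \<le> mdist (boundary_functions L X \<alpha>) (?R x) (?R y)"
  proof -
    \<comment> \<open>At \<open>w\<close> the two travel time functions differ by exactly d(x, y),
      so the supremum is attained there.\<close>
    obtain w where w: "w \<in> label_boundary L \<alpha>" "mdist X x w = mdist X x y + mdist X y w"
      using simple_exists_boundary_point_beyond[OF S x y] .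
    have "dist (?R x w) (?R y w) \<le> mdist (boundary_functions L X \<alpha>) (?R x) (?R y)"
      using mdist_cfunspace_imp_mdist_le[OF _ _ order_refl, of "?R x" _ euclidean_metric "?R y" w]
        travel_time_map_in_mspace[OF lab x] travel_time_map_in_mspace[OF lab y] w(1) top
      unfolding boundary_functions_def by simp
    then show ?thesis
      using w by (simp add: travel_time_map_def dist_real_def)
  qed
  ultimately show "mdist (boundary_functions L X \<alpha>) (?R x) (?R y) = mdist X x y"
    by (rule order_antisym)
qed

lemma compactin_travel_time_data:
  assumes S: "simple_labeled_metric_space L X \<alpha>"
  shows "compactin (mtopology_of (boundary_functions L X \<alpha>)) (travel_time_map L X \<alpha> ` mspace X)"
proof -
  have "compact_space (mtopology_of X)"
    using S unfolding simple_labeled_metric_space_def labeled_metric_space_def by blast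
  then show ?thesis
    using image_compactin isometric_embedding_imp_continuous_map
      isometric_embedding_travel_time_map[OF S]
    by (metis compact_space_def topspace_mtopology_of)
qed

text \<open>The image of the compact space is compact in a Hausdorff space, hence closed, and the
  closure adds no points.\<close>

lemma travel_time_closure_eq:
  assumes S: "simple_labeled_metric_space L X \<alpha>"
  shows "travel_time_closure L X \<alpha> =
    submetric (boundary_functions L X \<alpha>) (travel_time_map L X \<alpha> ` mspace X)"
proof -
  have "Hausdorff_space (mtopology_of (boundary_functions L X \<alpha>))"
    by (simp add: Metric_space.Hausdorff_space_mtopology mtopology_of_def)
  then have "closedin (mtopology_of (boundary_functions L X \<alpha>)) (travel_time_map L X \<alpha> ` mspace X)"
    using compactin_imp_closedin compactin_travel_time_data[OF S] by blast
  then show ?thesis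
    unfolding travel_time_closure_def by (simp add: closure_of_closedin)
qed

lemma isometric_travel_time_closure:
  assumes S: "simple_labeled_metric_space L X \<alpha>"
  shows "isometric X (travel_time_closure L X \<alpha>)"
  using isometric_embedding_travel_time_map[OF S]
  unfolding isometric_def travel_time_closure_eq[OF S] isometric_embedding_def
  by (intro exI[of _ "travel_time_map L X \<alpha>"]) auto

theorem lemma5p5:
  fixes L :: "'l set"
    and X :: "'a metric" and \<alpha> :: "'l \<Rightarrow> 'a"
    and Y :: "'b metric" and \<beta> :: "'l \<Rightarrow> 'b"
  assumes "simple_labeled_metric_space L X \<alpha>"
  shows "isometric_embedding X (boundary_functions L X \<alpha>) (travel_time_map L X \<alpha>) \<and>
         compact_space (mtopology_of (travel_time_closure L X \<alpha>)) \<and>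
         (simple_labeled_metric_space L Y \<beta> \<longrightarrow>
          isometric (travel_time_closure L X \<alpha>) (travel_time_closure L Y \<beta>) \<longrightarrow>
          isometric X Y)"
proof (intro conjI impI)
  show "isometric_embedding X (boundary_functions L X \<alpha>) (travel_time_map L X \<alpha>)"
    using assms by (rule isometric_embedding_travel_time_map)
  show "compact_space (mtopology_of (travel_time_closure L X \<alpha>))"
    using compactin_travel_time_data[OF assms]
    by (simp add: travel_time_closure_eq[OF assms] mtopology_of_submetric compact_space_subtopology)
  assume Y: "simple_labeled_metric_space L Y \<beta>"
    and iso: "isometric (travel_time_closure L X \<alpha>) (travel_time_closure L Y \<beta>)"
  \<comment> \<open>Each space is isometric to its own travel time closure, so the given isometry is
    transported along the two travel time maps.\<close>
  have "isometric X (travel_time_closure L Y \<beta>)"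
    using isometric_travel_time_closure[OF assms] iso by (rule isometric_trans)
  then show "isometric X Y"
    using isometric_sym[OF isometric_travel_time_closure[OF Y]] by (rule isometric_trans)
qed

end
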